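(* Let $n \geq 1$ and let $A \in \mathcal{C}^n$ be an extremal copositive matrix. Then the following are equivalent: (i) All minimal zeros of $A$ have support of cardinality two. (ii) There exist a positive definite diagonal matrix $D$ (real, of size $n \times n$) and an extremal copositive matrix $\Sigma \in \mathcal{C}^n$ with unit diagonal (i.e., $\Sigma_{ii} = 1$ for all $i = 1,\dots,n$) and with all elements from the set $\{-1,0,1\}$ such that $A = D\Sigma D$.
   Context: Let $\mathcal{S}^n$ be the space of real symmetric $n \times n$ matrices. A matrix $A \in \mathcal{S}^n$ is called copositive if $x^T A x \geq 0$ for all vectors $x \in \mathbb{R}_+^n$ (entrywise nonnegative vectors). The set of such matrices is the copositive cone $\mathcal{C}^n$. An element $x$ of a regular convex cone $K$ is called extremal if a decomposition $x = x_1 + x_2$ of $x$ into elements $x_1, x_2 \in K$ is only possible if $x_1 = \lambda x$, $x_2 = (1-\lambda)x$ for some $\lambda \in [0,1]$. An extremal copositive matrix is an extremal element of the cone $K = \mathcal{C}^n$. A zero of a copositive matrix $A \in \mathcal{C}^n$ is a non-zero nonnegative vector $u \in \mathbb{R}_+^n$ such that $u^T A u = 0$. The support of $u = (u_1,\dots,u_n)^T \in \mathbb{R}_+^n$ is $\mathrm{supp}\, u = \{ j \in \{1,\dots,n\} : u_j > 0 \}$. A zero $u$ of $A$ is called minimal if there exists no zero $v$ of $A$ such that $\mathrm{supp}\, v$ is a strict subset of $\mathrm{supp}\, u$. *)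

theory Defs
  imports "HOL-Analysis.Analysis"
begin

definition nonneg_vec :: "real ^ 'n \<Rightarrow> bool" where
  "nonneg_vec x \<longleftrightarrow> (\<forall>i. 0 \<le> x $ i)"

definition copositive_cone :: "(real ^ 'n ^ 'n) set" where
  "copositive_cone = {A. transpose A = A \<and> (\<forall>x. nonneg_vec x \<longrightarrow> 0 \<le> x \<bullet> (A *v x))}"

text \<open>As in the source definition, the origin is not excluded: in a pointed cone it is
  extremal in this sense.\<close>

definition extremal_in :: "'a::real_vector set \<Rightarrow> 'a \<Rightarrow> bool" where
  "extremal_in K x \<longleftrightarrow> x \<in> K \<and>
     (\<forall>x1\<in>K. \<forall>x2\<in>K. x = x1 + x2 \<longrightarrow>
        (\<exists>t::real. 0 \<le> t \<and> t \<le> 1 \<and> x1 = t *\<^sub>R x \<and> x2 = (1 - t) *\<^sub>R x))"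

definition supp :: "real ^ 'n \<Rightarrow> 'n set" where
  "supp u = {j. 0 < u $ j}"

definition is_zero_of :: "real ^ 'n ^ 'n \<Rightarrow> real ^ 'n \<Rightarrow> bool" where
  "is_zero_of A u \<longleftrightarrow> u \<noteq> 0 \<and> nonneg_vec u \<and> u \<bullet> (A *v u) = 0"

definition is_minimal_zero_of :: "real ^ 'n ^ 'n \<Rightarrow> real ^ 'n \<Rightarrow> bool" where
  "is_minimal_zero_of A u \<longleftrightarrow> is_zero_of A u \<and> \<not> (\<exists>v. is_zero_of A v \<and> supp v \<subset> supp u)"

definition diagonal_mat :: "real ^ 'n ^ 'n \<Rightarrow> bool" where
  "diagonal_mat D \<longleftrightarrow> (\<forall>i j. i \<noteq> j \<longrightarrow> D $ i $ j = 0)"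

definition positive_definite :: "real ^ 'n ^ 'n \<Rightarrow> bool" where
  "positive_definite D \<longleftrightarrow> transpose D = D \<and> (\<forall>x. x \<noteq> 0 \<longrightarrow> 0 < x \<bullet> (D *v x))"

end

theory Submission
  imports Defs
begin

text \<open>
  A matrix $A = D \Sigma D$ with positive diagonal $D$ has the same minimal zeros as $\Sigma$ up
  to a positive rescaling of the coordinates (\<open>minimal_zero_diag_congruence\<close>), so both
  directions can be discussed for matrices with unit diagonal.

  If $\Sigma$ has unit diagonal and entries in $\{-1,0,1\}$ and $u$ is a zero, then some entry
  with both indices in the support of $u$ is $-1$, since otherwise $u^T \Sigma u \ge \sum_i
  u_i^2 > 0$. Such an entry $\Sigma_{ij} = -1$ makes $e_i + e_j$ a zero, so the support of a
  minimal $u$ is exactly $\{i,j\}$ (\<open>sign_matrix_minimal_zeros_pairs\<close>).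

  Conversely, let all minimal zeros of the extremal matrix $A$ be supported on pairs. Then no $e_i$
  is a zero, the diagonal of $A$ is positive, and $A$ can be scaled to have unit diagonal. Its
  minimal zeros are now the multiples of $e_i + e_j$ for pairs with $A_{ij} = -1$. Let $B$ be
  obtained from $A$ by erasing all entries outside $\{-1, 1\}$. A gradient entry
  $A_{ki} + A_{kj}$ that vanishes consists of two opposite numbers, and these are kept or erased
  together; so $B_{ki} + B_{kj} = 0$ as well. That is, $(Bu)_k = 0$ whenever $u$ is a minimal zero
  and $(Au)_k = 0$. This suffices for $A \pm \epsilon B$ to be copositive for small
  $\epsilon > 0$ (\<open>copositive_perturbation\<close>), and as $A$ is the average of these two
  matrices, extremality forces $B$ to be a multiple of $A$. Comparing diagonals gives $B = A$, so
  $A$ has no entries outside $\{-1,0,1\}$.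

  The analytic part is the perturbation lemma, proved by induction on the face of the nonnegative
  orthant. If a face contains a minimal zero $u$ with $Au = 0$ on the face, then also $Bu = 0$
  there, and every point of the face can be moved along $u$ to a proper subface without changing
  the value of the perturbed form. Otherwise compactness shows that, for small perturbations, every
  nonzero point of the face has a positive gradient component, so that a minimizer with negative
  value cannot lie in the relative interior of the face.
\<close>

section \<open>Quadratic forms and supports\<close>

lemma form_symmetric:
  fixes A :: "real ^ 'n ^ 'n"
  assumes "transpose A = A"
  shows "x \<bullet> (A *v y) = y \<bullet> (A *v x)"
  by (metis assms dot_lmul_matrix inner_commute transpose_matrix_vector)

lemma form_add:
  fixes A :: "real ^ 'n ^ 'n"
  assumes "transpose A = A"
  shows "(x + s *\<^sub>R y) \<bullet> (A *v (x + s *\<^sub>R y))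
    = x \<bullet> (A *v x) + 2 * s * (y \<bullet> (A *v x)) + s\<^sup>2 * (y \<bullet> (A *v y))"
  using form_symmetric[OF assms, of x y]
  by (simp add: matrix_vector_right_distrib matrix_vector_mult_scaleR inner_add_left
      inner_add_right algebra_simps power2_eq_square)

lemma axis_form:
  fixes A :: "real ^ 'n ^ 'n"
  shows "axis i 1 \<bullet> (A *v axis j 1) = A $ i $ j"
  by (simp add: matrix_vector_mult_basis inner_axis' column_def)

lemma perturbed_mult:
  fixes A B :: "real ^ 'n ^ 'n"
  shows "(A + t *\<^sub>R B) *v x = A *v x + t *\<^sub>R (B *v x)"
  by (simp add: matrix_vector_mult_add_rdistrib scaleR_matrix_vector_assoc)

lemma copositive_sym: "A \<in> copositive_cone \<Longrightarrow> transpose A = A"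
  by (simp add: copositive_cone_def)

lemma copositive_form: "A \<in> copositive_cone \<Longrightarrow> nonneg_vec x \<Longrightarrow> 0 \<le> x \<bullet> (A *v x)"
  by (simp add: copositive_cone_def)

lemma sym_entry: "transpose A = A \<Longrightarrow> A $ i $ j = A $ j $ i"
  by (metis transpose_def vec_lambda_beta)

lemma nonneg_axis: "nonneg_vec (axis i (1::real))"
  by (simp add: nonneg_vec_def axis_def)

lemma nonneg_zero_off_supp: "nonneg_vec x \<Longrightarrow> i \<notin> supp x \<Longrightarrow> x $ i = 0"
  by (simp add: nonneg_vec_def supp_def antisym not_less)

lemma supp_nonempty: "nonneg_vec x \<Longrightarrow> x \<noteq> 0 \<Longrightarrow> supp x \<noteq> {}"
  by (metis empty_iff nonneg_zero_off_supp vec_eq_iff zero_index)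

section \<open>Zeros of copositive matrices\<close>

text \<open>A zero minimizes the form over the nonnegative orthant, so the derivative in each
  coordinate direction is nonnegative.\<close>

lemma zero_gradient_nonneg:
  assumes A: "A \<in> copositive_cone" and u: "nonneg_vec u" "u \<bullet> (A *v u) = 0"
  shows "0 \<le> (A *v u) $ i"
proof (rule ccontr)
  define c where "c = (A *v u) $ i"
  define a where "a = A $ i $ i"
  assume "\<not> 0 \<le> (A *v u) $ i"
  then have c: "c < 0" by (simp add: c_def)
  have a: "a \<ge> 0"
    using copositive_form[OF A nonneg_axis, of i] by (simp add: axis_form a_def)
  (* The form at u + s e_i is s (2 c + s a); this s makes s a smaller than - c. *)
  define s where "s = - c / (a + 1)"
  have s: "s > 0" unfolding s_def using c a by (intro divide_pos_pos) auto
  have "nonneg_vec (u + s *\<^sub>R axis i 1)"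
    using u(1) s by (simp add: nonneg_vec_def axis_def)
  from copositive_form[OF A this]
  have "0 \<le> 2 * s * c + s\<^sup>2 * a"
    unfolding form_add[OF copositive_sym[OF A]] axis_form
    by (simp add: u(2) a_def c_def inner_axis')
  then have "0 \<le> s * (2 * c + s * a)" by (simp add: algebra_simps power2_eq_square)
  then have "0 \<le> 2 * c + s * a" using s by (simp add: zero_le_mult_iff)
  moreover have "s * a \<le> s * (a + 1)" using s by simp
  moreover have "s * (a + 1) = - c" using a by (simp add: s_def)
  ultimately show False using c by simp
qed

lemma minimal_zero_below:
  fixes x :: "real ^ 'n"
  assumes "is_zero_of A x"
  obtains u where "is_minimal_zero_of A u" "supp u \<subseteq> supp x"
proof -
  let ?P = "\<lambda>v. is_zero_of A v \<and> supp v \<subseteq> supp x"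
  have "?P x" using assms by simp
  then obtain u where u: "?P u" and least: "\<And>v. ?P v \<Longrightarrow> card (supp u) \<le> card (supp v)"
    using ex_has_least_nat[of ?P x "\<lambda>v. card (supp v)"] by auto
  have "\<not> supp v \<subset> supp u" if "is_zero_of A v" for v
  proof
    assume "supp v \<subset> supp u"
    moreover from this have "card (supp v) < card (supp u)" by (intro psubset_card_mono) simp
    ultimately show False using least[of v] that u by force
  qed
  then show ?thesis using that u by (auto simp: is_minimal_zero_of_def)
qed

text \<open>Subtracting \<open>u\<close> from \<open>x\<close> until a coordinate in the support of \<open>u\<close>
  vanishes is the step by which a point of a face is moved to a proper subface.\<close>

lemma largest_multiple_below:
  fixes x u :: "real ^ 'n"
  assumes x: "nonneg_vec x" and u: "nonneg_vec u" "u \<noteq> 0"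
  obtains s where "0 \<le> s" "nonneg_vec (x - s *\<^sub>R u)"
    "\<exists>i\<in>supp u. i \<notin> supp (x - s *\<^sub>R u)"
    "supp u \<subseteq> supp x \<Longrightarrow> 0 < s"
proof -
  let ?q = "\<lambda>i. x $ i / u $ i"
  define s where "s = Min (?q ` supp u)"
  have ne: "supp u \<noteq> {}" by (rule supp_nonempty[OF u])
  have "s \<in> ?q ` supp u" unfolding s_def by (rule Min_in) (use ne in auto)
  then obtain i where i: "i \<in> supp u" "s = ?q i" by auto
  have least: "s \<le> ?q j" if "j \<in> supp u" for j
    unfolding s_def by (rule Min_le) (use that in auto)
  have "0 \<le> s" using i x u by (simp add: nonneg_vec_def)
  moreover have "nonneg_vec (x - s *\<^sub>R u)"
    unfolding nonneg_vec_def
  proof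
    fix j
    show "0 \<le> (x - s *\<^sub>R u) $ j"
    proof (cases "j \<in> supp u")
      case True
      then show ?thesis using least[OF True] by (simp add: supp_def field_simps)
    next
      case False
      then show ?thesis using nonneg_zero_off_supp[OF u(1) False] x by (simp add: nonneg_vec_def)
    qed
  qed
  moreover have "i \<notin> supp (x - s *\<^sub>R u)" using i by (simp add: supp_def)
  moreover have "0 < s" if "supp u \<subseteq> supp x"
    using i that by (auto simp: supp_def)
  ultimately show ?thesis using that i(1) by blast
qed

text \<open>A point whose gradient is nonpositive on a face containing it is itself a zero. Writing
  it as \<open>s u + y\<close> with a minimal zero \<open>u\<close> makes \<open>y\<close> a zero or
  the origin; the gradients of \<open>u\<close> and \<open>y\<close> are then both nonnegative, so
  they can only add up to a nonpositive vector on the face if they vanish there.\<close>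

lemma minimal_zero_on_stationary_face:
  fixes A :: "real ^ 'n ^ 'n"
  assumes A: "A \<in> copositive_cone" and x: "nonneg_vec x" "x \<noteq> 0" "supp x \<subseteq> I"
    and le: "\<And>i. i \<in> I \<Longrightarrow> (A *v x) $ i \<le> 0"
  obtains u where "is_minimal_zero_of A u" "supp u \<subseteq> I" "\<And>i. i \<in> I \<Longrightarrow> (A *v u) $ i = 0"
proof -
  note sym = copositive_sym[OF A]
  have "x \<bullet> (A *v x) = (\<Sum>i\<in>UNIV. x $ i * (A *v x) $ i)" by (simp add: inner_vec_def)
  also have "\<dots> \<le> 0"
  proof (rule sum_nonpos)
    fix i
    show "x $ i * (A *v x) $ i \<le> 0"
      using nonneg_zero_off_supp[OF x(1), of i] x(1,3) le[of i]
      by (cases "i \<in> supp x") (auto simp: nonneg_vec_def mult_nonneg_nonpos)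
  qed
  finally have x0: "x \<bullet> (A *v x) = 0" using copositive_form[OF A x(1)] by simp
  have Ax: "0 \<le> (A *v x) $ i" for i by (rule zero_gradient_nonneg[OF A x(1) x0])
  obtain u where u: "is_minimal_zero_of A u" "supp u \<subseteq> supp x"
    using minimal_zero_below[of A x] x x0 by (auto simp: is_zero_of_def)
  then have u': "nonneg_vec u" "u \<noteq> 0" "u \<bullet> (A *v u) = 0"
    by (auto simp: is_minimal_zero_of_def is_zero_of_def)
  obtain s where s: "0 < s" "nonneg_vec (x - s *\<^sub>R u)"
    using largest_multiple_below[OF x(1) u'(1,2)] u(2) by metis
  define y where "y = x - s *\<^sub>R u"
  have y: "nonneg_vec y" using s by (simp add: y_def)
  have "0 \<le> u \<bullet> (A *v x)"
    unfolding inner_vec_def by (rule sum_nonneg) (use Ax u'(1) in \<open>simp add: nonneg_vec_def\<close>)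
  then have "y \<bullet> (A *v y) \<le> 0"
    using form_add[OF sym, of x "-s" u] s(1) by (simp add: y_def x0 u'(3))
  then have y0: "y \<bullet> (A *v y) = 0" using copositive_form[OF A y] by simp
  have "(A *v u) $ i = 0" if "i \<in> I" for i
  proof -
    have "A *v x = A *v y + s *\<^sub>R (A *v u)"
      by (simp add: y_def matrix_vector_mult_diff_distrib matrix_vector_mult_scaleR)
    then have "(A *v x) $ i = (A *v y) $ i + s * (A *v u) $ i" by simp
    moreover have "0 \<le> (A *v y) $ i" by (rule zero_gradient_nonneg[OF A y y0])
    moreover have "0 \<le> (A *v u) $ i" by (rule zero_gradient_nonneg[OF A u'(1,3)])
    ultimately have "s * (A *v u) $ i \<le> 0" using le[OF that] by simp
    then show ?thesis using s(1) \<open>0 \<le> (A *v u) $ i\<close> by (simp add: mult_le_0_iff)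
  qed
  then show ?thesis using that u x(3) by blast
qed

section \<open>Perturbation of copositive matrices\<close>

lemma closed_face: "closed {x :: real ^ 'n. nonneg_vec x \<and> supp x \<subseteq> I}"
proof -
  have "{x :: real ^ 'n. nonneg_vec x \<and> supp x \<subseteq> I}
      = (\<Inter>i. {x. 0 \<le> x $ i}) \<inter> (\<Inter>i\<in>-I. {x. x $ i = 0})"
    by (auto simp: nonneg_vec_def supp_def less_le)
  also have "closed \<dots>"
    by (intro closed_Int closed_INT ballI closed_Collect_le closed_Collect_eq continuous_intros)
  finally show ?thesis .
qed

lemma continuous_mult_component:
  fixes M :: "real ^ 'n ^ 'n"
  shows "continuous_on S (\<lambda>x. (M *v x) $ i)"
  by (intro continuous_intros linear_continuous_on matrix_vector_mul_bounded_linear)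

text \<open>The condition does not depend on the length of \<open>x\<close>, so it suffices to treat the
  compact set of unit vectors in the face. There the sum \<open>h\<close> of the positive parts of the
  components of \<open>A x\<close> is bounded away from zero, while a perturbed vector without positive
  component would require \<open>h x\<close> to be at most \<open>\<bar>t\<bar>\<close> times
  a bounded quantity.\<close>

lemma uniform_positive_component:
  fixes A B :: "real ^ 'n ^ 'n"
  assumes pos: "\<And>x. nonneg_vec x \<Longrightarrow> x \<noteq> 0 \<Longrightarrow> supp x \<subseteq> I \<Longrightarrow> \<exists>i\<in>I. 0 < (A *v x) $ i"
  obtains e where "0 < e"
    "\<And>t x. \<bar>t\<bar> \<le> e \<Longrightarrow> nonneg_vec x \<Longrightarrow> x \<noteq> 0 \<Longrightarrow> supp x \<subseteq> I
       \<Longrightarrow> \<exists>i\<in>I. 0 < ((A + t *\<^sub>R B) *v x) $ i"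
proof -
  define S where "S = sphere (0::real ^ 'n) 1 \<inter> {x. nonneg_vec x \<and> supp x \<subseteq> I}"
  define h where "h x = (\<Sum>i\<in>I. max 0 ((A *v x) $ i))" for x
  define g where "g x = (\<Sum>i\<in>I. \<bar>(B *v x) $ i\<bar>)" for x
  have S: "compact S" unfolding S_def by (intro compact_Int_closed compact_sphere closed_face)
  have h: "continuous_on S h"
    unfolding h_def by (intro continuous_intros continuous_mult_component)
  have g: "continuous_on S g"
    unfolding g_def by (intro continuous_intros continuous_mult_component)
  have hpos: "0 < h x" if xS: "x \<in> S" for x
  proof -
    have "x \<noteq> 0" using xS by (auto simp: S_def)
    then obtain i where "i \<in> I" "0 < (A *v x) $ i"
      using pos[of x] xS unfolding S_def by blast
    then show ?thesis unfolding h_def by (intro sum_pos2[of _ i]) auto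
  qed
  obtain \<delta> where \<delta>: "0 < \<delta>" "\<And>x. x \<in> S \<Longrightarrow> \<delta> \<le> h x"
  proof (cases "S = {}")
    case True
    then show ?thesis using that[of 1] by simp
  next
    case False
    then show ?thesis using continuous_attains_inf[OF S False h] hpos that by blast
  qed
  obtain G where G: "0 < G" "\<And>x. x \<in> S \<Longrightarrow> g x \<le> G"
    using compact_imp_bounded[OF compact_continuous_image[OF g S]]
    unfolding bounded_pos by (auto intro: order_trans[OF abs_ge_self])
  define e where "e = \<delta> / (2 * G)"
  have e: "0 < e" using \<delta> G by (simp add: e_def)
  have "\<exists>i\<in>I. 0 < ((A + t *\<^sub>R B) *v x) $ i"
    if t: "\<bar>t\<bar> \<le> e" and x: "nonneg_vec x" "x \<noteq> 0" "supp x \<subseteq> I" for t x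
  proof (rule ccontr)
    assume neg: "\<not> ?thesis"
    define y where "y = (1 / norm x) *\<^sub>R x"
    have y: "y \<in> S"
      using x by (auto simp: S_def y_def nonneg_vec_def supp_def zero_less_divide_iff)
    have *: "max 0 ((A *v y) $ i) \<le> e * \<bar>(B *v y) $ i\<bar>" if "i \<in> I" for i
    proof -
      have "((A + t *\<^sub>R B) *v y) $ i = (1 / norm x) * ((A + t *\<^sub>R B) *v x) $ i"
        by (simp add: y_def matrix_vector_mult_scaleR)
      also have "\<dots> \<le> 0"
        by (rule mult_nonneg_nonpos) (use neg that in \<open>auto simp: not_less\<close>)
      finally have "(A *v y) $ i \<le> - (t * (B *v y) $ i)" by (simp add: perturbed_mult)
      also have "\<dots> \<le> \<bar>t\<bar> * \<bar>(B *v y) $ i\<bar>" by (metis abs_ge_minus_self abs_mult)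
      also have "\<dots> \<le> e * \<bar>(B *v y) $ i\<bar>" using t by (intro mult_right_mono) auto
      finally show ?thesis using e by simp
    qed
    have "\<delta> \<le> h y" by (rule \<delta>(2)[OF y])
    also have "\<dots> \<le> e * g y" unfolding h_def g_def sum_distrib_left by (rule sum_mono) (rule *)
    also have "\<dots> \<le> e * G" using e G(2)[OF y] by simp
    also have "\<dots> = \<delta> / 2" using G(1) by (simp add: e_def)
    finally show False using \<delta>(1) by simp
  qed
  then show ?thesis using that e by blast
qed

text \<open>Minimize the form over the part of the face in the unit ball. If the minimum were
  negative, the minimizer would have full support, and decreasing a coordinate with positive
  gradient would lower the value further. Decreasing a coordinate also keeps the point in the unit
  ball, which is why the ball is used and not a simplex or a sphere.\<close>

lemma face_nonneg_if_boundary_nonneg: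
  fixes M :: "real ^ 'n ^ 'n"
  assumes sym: "transpose M = M"
    and boundary: "\<And>x. nonneg_vec x \<Longrightarrow> supp x \<subset> I \<Longrightarrow> 0 \<le> x \<bullet> (M *v x)"
    and descent: "\<And>x. nonneg_vec x \<Longrightarrow> x \<noteq> 0 \<Longrightarrow> supp x \<subseteq> I \<Longrightarrow> \<exists>i\<in>I. 0 < (M *v x) $ i"
    and x: "nonneg_vec x" "supp x \<subseteq> I"
  shows "0 \<le> x \<bullet> (M *v x)"
proof (rule ccontr)
  assume neg: "\<not> ?thesis"
  define K where "K = cball (0::real ^ 'n) 1 \<inter> {x. nonneg_vec x \<and> supp x \<subseteq> I}"
  have "compact K" unfolding K_def by (intro compact_Int_closed compact_cball closed_face)
  moreover have "0 \<in> K" by (auto simp: K_def nonneg_vec_def supp_def)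
  moreover have "continuous_on K (\<lambda>z. z \<bullet> (M *v z))"
    by (intro continuous_intros linear_continuous_on matrix_vector_mul_bounded_linear)
  ultimately obtain z where z: "z \<in> K" and least: "\<And>w. w \<in> K \<Longrightarrow> z \<bullet> (M *v z) \<le> w \<bullet> (M *v w)"
    using continuous_attains_inf[of K] by blast
  have "x \<noteq> 0" using neg by auto
  then have xK: "(1 / norm x) *\<^sub>R x \<in> K"
    using x by (auto simp: K_def nonneg_vec_def supp_def zero_less_divide_iff)
  have "z \<bullet> (M *v z) \<le> (1 / norm x)\<^sup>2 * (x \<bullet> (M *v x))"
    using least[OF xK] by (simp add: matrix_vector_mult_scaleR power2_eq_square)
  also have "\<dots> < 0" using neg \<open>x \<noteq> 0\<close> by (auto intro: mult_pos_neg)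
  finally have zneg: "z \<bullet> (M *v z) < 0" .
  have z': "nonneg_vec z" "supp z \<subseteq> I" "norm z \<le> 1" using z by (auto simp: K_def)
  have "z \<noteq> 0" using zneg by auto
  then obtain i where i: "i \<in> I" "0 < (M *v z) $ i" using descent z' by blast
  have "supp z = I" using boundary[of z] z' zneg by auto
  then have zi: "0 < z $ i" using i by (auto simp: supp_def)
  define c where "c = (M *v z) $ i"
  define m where "m = \<bar>M $ i $ i\<bar>"
  (* The first bound keeps z - s e_i nonnegative; the second makes the quadratic term of the
     form at most s c, too small to compensate the linear decrease 2 s c. *)
  define s where "s = min (z $ i) (c / (m + 1))"
  have m: "0 \<le> m" and c: "0 < c" using i by (auto simp: m_def c_def)
  have s: "0 < s" "s \<le> z $ i" "s \<le> c / (m + 1)" using zi m c by (auto simp: s_def)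
  define w where "w = z + (- s) *\<^sub>R axis i 1"
  have wj: "w $ j = (if j = i then z $ i - s else z $ j)" for j
    by (simp add: w_def axis_def)
  have wz: "0 \<le> w $ j \<and> w $ j \<le> z $ j" for j
    using s z'(1) by (simp add: wj nonneg_vec_def)
  have "norm w \<le> norm z"
    by (rule norm_le_componentwise_cart) (use wz in \<open>smt (verit) real_norm_def\<close>)
  moreover have "supp w \<subseteq> supp z" unfolding supp_def by (auto intro: less_le_trans simp: wz)
  moreover have "nonneg_vec w" using wz by (simp add: nonneg_vec_def)
  ultimately have "w \<in> K" using z' by (auto simp: K_def)
  then have "z \<bullet> (M *v z) \<le> w \<bullet> (M *v w)" by (rule least)
  also have "\<dots> = z \<bullet> (M *v z) - 2 * s * c + s\<^sup>2 * M $ i $ i"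
    unfolding w_def form_add[OF sym] axis_form by (simp add: inner_axis' c_def)
  finally have "s * (2 * c) \<le> s * (s * M $ i $ i)" by (simp add: power2_eq_square algebra_simps)
  then have "2 * c \<le> s * M $ i $ i" using s by simp
  also have "\<dots> \<le> s * (m + 1)" using s by (intro mult_left_mono) (auto simp: m_def)
  also have "\<dots> \<le> c" using s(3) m by (simp add: pos_le_divide_eq)
  finally show False using c by simp
qed

text \<open>Induction on the face \<open>I\<close>; the proper subfaces are finitely many, so a common
  bound \<open>e0\<close> serves for all of them.\<close>

lemma copositive_perturbation_on_face:
  fixes A B :: "real ^ 'n ^ 'n"
  assumes A: "A \<in> copositive_cone" and B: "transpose B = B"
    and kernel: "\<And>u i. is_minimal_zero_of A u \<Longrightarrow> (A *v u) $ i = 0 \<Longrightarrow> (B *v u) $ i = 0"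
  shows "\<exists>e>0. \<forall>t x. \<bar>t\<bar> \<le> e \<longrightarrow> nonneg_vec x \<longrightarrow> supp x \<subseteq> I \<longrightarrow>
    0 \<le> x \<bullet> ((A + t *\<^sub>R B) *v x)"
    (is "\<exists>e>0. ?nonneg e I")
proof -
  have sym: "transpose (A + t *\<^sub>R B) = A + t *\<^sub>R B" for t
    using copositive_sym[OF A] B by (simp add: transpose_def vec_eq_iff)
  have "finite I" by simp
  then show ?thesis
  proof (induction I rule: finite_psubset_induct)
    case (psubset I)
    then obtain E where E: "\<And>J. J \<subset> I \<Longrightarrow> 0 < E J" "\<And>J. J \<subset> I \<Longrightarrow> ?nonneg (E J) J"
      by metis
    define e0 where "e0 = Min (insert 1 (E ` {J. J \<subset> I}))"
    have e0: "0 < e0" using E(1) by (simp add: e0_def)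
    have e0_le: "e0 \<le> E J" if "J \<subset> I" for J
      unfolding e0_def by (rule Min_le) (use that in auto)
    have boundary: "0 \<le> x \<bullet> ((A + t *\<^sub>R B) *v x)"
      if "\<bar>t\<bar> \<le> e0" "nonneg_vec x" "supp x \<subset> I" for t x
      using E(2)[OF that(3)] e0_le[OF that(3)] that(1,2) by (meson order_refl order_trans)
    show ?case
    proof (cases "\<exists>u. is_minimal_zero_of A u \<and> supp u \<subseteq> I \<and> (\<forall>i\<in>I. (A *v u) $ i = 0)")
      case True
      then obtain u where u: "is_minimal_zero_of A u" "supp u \<subseteq> I" "\<forall>i\<in>I. (A *v u) $ i = 0"
        by blast
      then have u': "nonneg_vec u" "u \<noteq> 0" by (auto simp: is_minimal_zero_of_def is_zero_of_def)
      have "0 \<le> x \<bullet> ((A + t *\<^sub>R B) *v x)"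
        if t: "\<bar>t\<bar> \<le> e0" and x: "nonneg_vec x" "supp x \<subseteq> I" for t x
      proof -
        (* Since ?M u vanishes on the face, the form of ?M is constant along u within it. *)
        let ?M = "A + t *\<^sub>R B"
        have Mu: "(?M *v u) $ i = 0" if "i \<in> I" for i
          using u(1,3) kernel that by (simp add: perturbed_mult)
        have ort: "w \<bullet> (?M *v u) = 0" if "nonneg_vec w" "supp w \<subseteq> I" for w
          unfolding inner_vec_def
          by (rule sum.neutral) (use that Mu nonneg_zero_off_supp[of w] in force)
        obtain s where s: "0 \<le> s" "nonneg_vec (x - s *\<^sub>R u)"
          and drop: "\<exists>i\<in>supp u. i \<notin> supp (x - s *\<^sub>R u)"
          using largest_multiple_below[OF x(1) u'] by metis
        have "(x - s *\<^sub>R u) $ i \<le> x $ i" for i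
          using s(1) u'(1) by (simp add: nonneg_vec_def)
        then have "supp (x - s *\<^sub>R u) \<subseteq> supp x"
          unfolding supp_def by (blast intro: less_le_trans)
        then have "supp (x - s *\<^sub>R u) \<subset> I" using drop u(2) x(2) by blast
        then have "0 \<le> (x - s *\<^sub>R u) \<bullet> (?M *v (x - s *\<^sub>R u))" using boundary t s(2) by blast
        also have "\<dots> = x \<bullet> (?M *v x)"
          using form_add[OF sym, of x "- s" u] ort[OF x] ort[OF u'(1) u(2)]
            form_symmetric[OF sym, of x t u] by simp
        finally show ?thesis .
      qed
      then show ?thesis using e0 by blast
    next
      case False
      have "\<exists>i\<in>I. 0 < (A *v x) $ i" if "nonneg_vec x" "x \<noteq> 0" "supp x \<subseteq> I" for x
        using minimal_zero_on_stationary_face[OF A that] False by (metis linorder_not_less)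
      then obtain e1 where e1: "0 < e1"
        and descent: "\<And>t x. \<bar>t\<bar> \<le> e1 \<Longrightarrow> nonneg_vec x \<Longrightarrow> x \<noteq> 0 \<Longrightarrow> supp x \<subseteq> I
          \<Longrightarrow> \<exists>i\<in>I. 0 < ((A + t *\<^sub>R B) *v x) $ i"
        using uniform_positive_component[of I A B] by metis
      have "?nonneg (min e0 e1) I"
        using face_nonneg_if_boundary_nonneg[OF sym] boundary descent by (metis min.boundedE)
      then show ?thesis using e0 e1 by (metis min_less_iff_conj)
    qed
  qed
qed

text \<open>The hypothesis \<open>kernel\<close> is a linear system in \<open>B\<close>, of which
  \<open>A\<close> is a solution. Every symmetric solution is a direction in which the cone contains
  a segment with midpoint \<open>A\<close>.\<close>

lemma copositive_perturbation:
  fixes A B :: "real ^ 'n ^ 'n"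
  assumes A: "A \<in> copositive_cone" and B: "transpose B = B"
    and kernel: "\<And>u i. is_minimal_zero_of A u \<Longrightarrow> (A *v u) $ i = 0 \<Longrightarrow> (B *v u) $ i = 0"
  obtains e where "0 < e" "A + e *\<^sub>R B \<in> copositive_cone" "A - e *\<^sub>R B \<in> copositive_cone"
proof -
  obtain e where e: "0 < e"
    and form: "\<And>t x. \<bar>t\<bar> \<le> e \<Longrightarrow> nonneg_vec x \<Longrightarrow> 0 \<le> x \<bullet> ((A + t *\<^sub>R B) *v x)"
    using copositive_perturbation_on_face[OF assms, where I = UNIV] by auto
  have "A + t *\<^sub>R B \<in> copositive_cone" if "\<bar>t\<bar> \<le> e" for t
    using form[OF that] copositive_sym[OF A] B
    by (auto simp: copositive_cone_def transpose_def vec_eq_iff)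
  from this[of e] this[of "- e"] show ?thesis using that e by simp
qed

text \<open>For an extremal \<open>A\<close> the symmetric solutions of this linear system are just the
  multiples of \<open>A\<close>.\<close>

lemma extremal_perturbation_multiple:
  fixes A B :: "real ^ 'n ^ 'n"
  assumes ext: "extremal_in copositive_cone A" and B: "transpose B = B"
    and kernel: "\<And>u i. is_minimal_zero_of A u \<Longrightarrow> (A *v u) $ i = 0 \<Longrightarrow> (B *v u) $ i = 0"
  obtains c where "B = c *\<^sub>R A"
proof -
  have A: "A \<in> copositive_cone" using ext by (simp add: extremal_in_def)
  obtain e where e: "0 < e" "A + e *\<^sub>R B \<in> copositive_cone" "A - e *\<^sub>R B \<in> copositive_cone"
    using copositive_perturbation[OF A B kernel] by metis
  have half: "(1/2) *\<^sub>R M \<in> copositive_cone" if "M \<in> copositive_cone" for M :: "real ^ 'n ^ 'n"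
    using that
    by (auto simp: copositive_cone_def transpose_def vec_eq_iff
        simp flip: scaleR_matrix_vector_assoc)
  have "A = (1/2) *\<^sub>R (A + e *\<^sub>R B) + (1/2) *\<^sub>R (A - e *\<^sub>R B)"
    by (simp add: vec_eq_iff field_simps)
  then obtain t where "(1/2) *\<^sub>R (A + e *\<^sub>R B) = t *\<^sub>R A"
    using ext half[OF e(2)] half[OF e(3)] unfolding extremal_in_def by blast
  then have "(e / 2) *\<^sub>R B = (t - 1/2) *\<^sub>R A"
    by (simp add: vec_eq_iff algebra_simps)
  then have "(2 / e) *\<^sub>R (e / 2) *\<^sub>R B = (2 / e) *\<^sub>R (t - 1/2) *\<^sub>R A" by (rule arg_cong)
  then have "B = ((2 / e) * (t - 1/2)) *\<^sub>R A" using e(1) by simp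
  then show ?thesis by (rule that)
qed

section \<open>Diagonal congruences\<close>

definition diag_congruence :: "('n \<Rightarrow> real) \<Rightarrow> real ^ 'n ^ 'n \<Rightarrow> real ^ 'n ^ 'n" where
  "diag_congruence d A = (\<chi> i j. d i * A $ i $ j * d j)"

lemma form_diag_congruence:
  "x \<bullet> (diag_congruence d A *v x) = (\<chi> i. d i * x $ i) \<bullet> (A *v (\<chi> i. d i * x $ i))"
  by (simp add: inner_vec_def matrix_vector_mult_def diag_congruence_def sum_distrib_left mult_ac)

lemma diag_congruence_inverse:
  fixes d :: "'n::finite \<Rightarrow> real"
  assumes "\<And>i. 0 < d i"
  shows "diag_congruence d (diag_congruence (\<lambda>i. 1 / d i) A) = A"
    and "diag_congruence (\<lambda>i. 1 / d i) (diag_congruence d A) = A"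
  using less_imp_neq[OF assms] by (auto simp: diag_congruence_def vec_eq_iff)

lemma diag_congruence_copositive:
  fixes d :: "'n::finite \<Rightarrow> real"
  assumes "\<And>i. 0 < d i" "A \<in> copositive_cone"
  shows "diag_congruence d A \<in> copositive_cone"
proof -
  have "transpose (diag_congruence d A) = diag_congruence d A"
    using sym_entry[OF copositive_sym[OF assms(2)]]
    by (simp add: transpose_def diag_congruence_def vec_eq_iff mult_ac)
  moreover have "nonneg_vec (\<chi> i. d i * x $ i)" if "nonneg_vec x" for x
    using that assms(1) by (simp add: nonneg_vec_def less_imp_le)
  ultimately show ?thesis
    using copositive_form[OF assms(2)] by (simp add: copositive_cone_def form_diag_congruence)
qed

text \<open>A diagonal congruence is a linear bijection of the copositive cone onto itself, with the
  reciprocal congruence as its inverse.\<close>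

lemma diag_congruence_extremal:
  fixes d :: "'n::finite \<Rightarrow> real"
  assumes d: "\<And>i. 0 < d i" and A: "extremal_in copositive_cone A"
  shows "extremal_in copositive_cone (diag_congruence d A)"
  unfolding extremal_in_def
proof (intro conjI ballI impI)
  let ?d' = "\<lambda>i. 1 / d i"
  have d': "\<And>i. 0 < ?d' i" using d by simp
  show "diag_congruence d A \<in> copositive_cone"
    using A d by (simp add: extremal_in_def diag_congruence_copositive)
  fix X Y assume X: "X \<in> copositive_cone" and Y: "Y \<in> copositive_cone"
    and eq: "diag_congruence d A = X + Y"
  have "A = diag_congruence ?d' (X + Y)"
    unfolding eq[symmetric] diag_congruence_inverse(2)[OF d] ..
  also have "\<dots> = diag_congruence ?d' X + diag_congruence ?d' Y"
    by (simp add: diag_congruence_def vec_eq_iff add_divide_distrib)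
  finally obtain t where t: "0 \<le> t" "t \<le> 1" "diag_congruence ?d' X = t *\<^sub>R A"
      "diag_congruence ?d' Y = (1 - t) *\<^sub>R A"
    using A diag_congruence_copositive[of ?d', OF d' X] diag_congruence_copositive[of ?d', OF d' Y]
    unfolding extremal_in_def by blast
  have scale: "diag_congruence d (s *\<^sub>R A) = s *\<^sub>R diag_congruence d A" for s
    by (simp add: diag_congruence_def vec_eq_iff)
  have "X = t *\<^sub>R diag_congruence d A" "Y = (1 - t) *\<^sub>R diag_congruence d A"
    using diag_congruence_inverse(1)[of d X, OF d] diag_congruence_inverse(1)[of d Y, OF d]
    by (simp_all add: t scale)
  then show "\<exists>t\<ge>0. t \<le> 1 \<and> X = t *\<^sub>R diag_congruence d A \<and> Y = (1 - t) *\<^sub>R diag_congruence d A"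
    using t by blast
qed

lemma zero_diag_congruence:
  fixes d :: "'n::finite \<Rightarrow> real"
  assumes d: "\<And>i. 0 < d i"
  shows "is_zero_of (diag_congruence d A) u \<longleftrightarrow> is_zero_of A (\<chi> i. d i * u $ i)"
proof -
  have "0 \<le> d i * x \<longleftrightarrow> 0 \<le> x" "d i * x = 0 \<longleftrightarrow> x = 0" for i x
    using d[of i] by (simp_all add: zero_le_mult_iff)
  then show ?thesis
    by (simp add: is_zero_of_def form_diag_congruence nonneg_vec_def vec_eq_iff)
qed

lemma supp_scaled:
  assumes "\<And>i. 0 < d i"
  shows "supp (\<chi> i. d i * u $ i) = supp u"
proof -
  have "0 < d i * x \<longleftrightarrow> 0 < x" for i x using assms[of i] by (simp add: zero_less_mult_iff)
  then show ?thesis by (simp add: supp_def)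
qed

lemma minimal_zero_diag_congruence:
  fixes d :: "'n::finite \<Rightarrow> real"
  assumes d: "\<And>i. 0 < d i" and u: "is_minimal_zero_of (diag_congruence d A) u"
  shows "is_minimal_zero_of A (\<chi> i. d i * u $ i)"
  unfolding is_minimal_zero_of_def
proof (intro conjI notI; (elim exE conjE)?)
  show "is_zero_of A (\<chi> i. d i * u $ i)"
    using u by (simp add: is_minimal_zero_of_def zero_diag_congruence[OF d])
  fix v assume v: "is_zero_of A v" "supp v \<subset> supp (\<chi> i. d i * u $ i)"
  define w where "w = (\<chi> i. 1 / d i * v $ i)"
  have "(\<chi> i. d i * w $ i) = v"
    using less_imp_neq[OF d] by (auto simp: w_def vec_eq_iff)
  then have "is_zero_of (diag_congruence d A) w" "supp w \<subset> supp u"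
    using v supp_scaled[of d w, OF d] by (simp_all add: zero_diag_congruence[OF d] supp_scaled[OF d])
  then show False using u by (auto simp: is_minimal_zero_of_def)
qed

lemma minimal_zeros_pairs_diag_congruence:
  fixes d :: "'n::finite \<Rightarrow> real"
  assumes d: "\<And>i. 0 < d i" and "\<And>u. is_minimal_zero_of A u \<Longrightarrow> card (supp u) = 2"
    and "is_minimal_zero_of (diag_congruence d A) u"
  shows "card (supp u) = 2"
  using assms(2)[OF minimal_zero_diag_congruence[OF d assms(3)]] by (simp add: supp_scaled[OF d])

lemma diagonal_product:
  fixes D :: "real ^ 'n ^ 'n"
  assumes D: "diagonal_mat D"
  shows "D ** S ** D = diag_congruence (\<lambda>i. D $ i $ i) S"
proof -
  define d where "d i = D $ i $ i" for i
  have entry: "D $ i $ j = (if i = j then d i else 0)" for i j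
    using D by (simp add: diagonal_mat_def d_def)
  have "(D ** S) $ i $ j = d i * S $ i $ j" for i j
    by (simp add: matrix_matrix_mult_def entry if_distrib[of "\<lambda>x. x * _"] cong: if_cong)
  then have "D ** S ** D = diag_congruence d S"
    by (simp add: vec_eq_iff diag_congruence_def matrix_matrix_mult_def[of "D ** S"] entry
        if_distrib[of "\<lambda>x. _ * x"] cong: if_cong)
  moreover have "d = (\<lambda>i. D $ i $ i)" by (simp add: d_def fun_eq_iff)
  ultimately show ?thesis by (simp only:)
qed

lemma diagonal_positive_definite_iff:
  fixes D :: "real ^ 'n ^ 'n"
  assumes D: "diagonal_mat D"
  shows "positive_definite D \<longleftrightarrow> (\<forall>i. 0 < D $ i $ i)"
proof
  assume pd: "positive_definite D"
  show "\<forall>i. 0 < D $ i $ i"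
  proof
    fix i
    have "axis i (1::real) \<noteq> (0 :: real ^ 'n)" by (simp add: axis_eq_0_iff)
    then have "0 < axis i 1 \<bullet> (D *v axis i 1)" using pd by (simp add: positive_definite_def)
    then show "0 < D $ i $ i" by (simp add: axis_form)
  qed
next
  assume pos: "\<forall>i. 0 < D $ i $ i"
  define d where "d i = D $ i $ i" for i
  have entry: "D $ i $ j = (if i = j then d i else 0)" for i j
    using D by (simp add: diagonal_mat_def d_def)
  have form: "x \<bullet> (D *v x) = (\<Sum>i\<in>UNIV. x $ i * (d i * x $ i))" for x
    by (simp add: inner_vec_def matrix_vector_mult_def entry if_distrib[of "\<lambda>x. x * _"]
        cong: if_cong)
  have term_nonneg: "0 \<le> x $ i * (d i * x $ i)" for x :: "real ^ 'n" and i
  proof -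
    have "0 \<le> d i * (x $ i)\<^sup>2" using pos by (simp add: d_def less_imp_le)
    then show ?thesis by (simp add: power2_eq_square mult_ac)
  qed
  have "transpose D = D" by (simp add: transpose_def vec_eq_iff entry)
  moreover have "0 < x \<bullet> (D *v x)" if x: "x \<noteq> 0" for x
  proof -
    obtain i where i: "x $ i \<noteq> 0" using x by (auto simp: vec_eq_iff)
    show ?thesis unfolding form
    proof (rule sum_pos2[of _ i])
      have "0 < d i * (x $ i)\<^sup>2" using i pos by (simp add: d_def)
      then show "0 < x $ i * (d i * x $ i)" by (simp add: power2_eq_square mult_ac)
    qed (simp_all add: term_nonneg)
  qed
  ultimately show "positive_definite D" by (simp add: positive_definite_def)
qed

section \<open>Minimal zeros supported on pairs\<close>

lemma pair_zero:
  fixes A :: "real ^ 'n ^ 'n"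
  assumes "A \<in> copositive_cone" "i \<noteq> j" "A $ i $ i = 1" "A $ j $ j = 1" "A $ i $ j = -1"
  shows "is_zero_of A (axis i 1 + axis j 1)" "supp (axis i 1 + axis j (1::real)) = {i, j}"
proof -
  have "(axis i 1 + axis j 1) \<bullet> (A *v (axis i 1 + axis j 1)) = 0"
    using form_add[OF copositive_sym[OF assms(1)], of "axis i 1" 1 "axis j 1"] assms
      sym_entry[OF copositive_sym[OF assms(1)], of i j] by (simp add: axis_form)
  moreover have "axis i 1 + axis j (1::real) \<noteq> 0"
    using assms(2) by (auto simp: vec_eq_iff axis_def intro!: exI[of _ i])
  ultimately show "is_zero_of A (axis i 1 + axis j 1)"
    by (simp add: is_zero_of_def nonneg_vec_def axis_def)
  show "supp (axis i 1 + axis j (1::real)) = {i, j}"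
    by (auto simp: supp_def axis_def)
qed

text \<open>Without an entry \<open>-1\<close> on the support of \<open>u\<close> all terms of the form
  at \<open>u\<close> are nonnegative, and the diagonal ones are positive on the support. An entry
  \<open>-1\<close> gives a zero with two positive coordinates inside that support.\<close>

lemma sign_matrix_minimal_zeros_pairs:
  fixes S :: "real ^ 'n ^ 'n"
  assumes S: "S \<in> copositive_cone" and diag: "\<And>i. S $ i $ i = 1"
    and entries: "\<And>i j. S $ i $ j \<in> {-1, 0, 1}" and u: "is_minimal_zero_of S u"
  shows "card (supp u) = 2"
proof -
  have u': "u \<noteq> 0" "nonneg_vec u" "u \<bullet> (S *v u) = 0"
    using u by (auto simp: is_minimal_zero_of_def is_zero_of_def)
  have "\<exists>i\<in>supp u. \<exists>j\<in>supp u. S $ i $ j = -1"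
  proof (rule ccontr)
    assume no: "\<not> ?thesis"
    have term_nonneg: "0 \<le> u $ i * (S $ i $ j * u $ j)" for i j
    proof (cases "i \<in> supp u \<and> j \<in> supp u")
      case True
      then have "0 \<le> S $ i $ j" using no entries[of i j] by auto
      then show ?thesis using u'(2) by (simp add: nonneg_vec_def)
    next
      case False
      then show ?thesis using nonneg_zero_off_supp[OF u'(2)] by auto
    qed
    obtain k where k: "k \<in> supp u" using supp_nonempty[OF u'(2,1)] by blast
    have "0 < (\<Sum>i\<in>UNIV. \<Sum>j\<in>UNIV. u $ i * (S $ i $ j * u $ j))"
    proof (rule sum_pos2[of _ k])
      show "0 < (\<Sum>j\<in>UNIV. u $ k * (S $ k $ j * u $ j))"
        by (rule sum_pos2[of _ k]) (use k term_nonneg diag in \<open>auto simp: supp_def\<close>)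
    qed (use term_nonneg in \<open>auto intro: sum_nonneg\<close>)
    also have "\<dots> = u \<bullet> (S *v u)"
      by (simp add: inner_vec_def matrix_vector_mult_def sum_distrib_left)
    finally show False using u'(3) by simp
  qed
  then obtain i j where ij: "i \<in> supp u" "j \<in> supp u" "S $ i $ j = -1" by blast
  then have "i \<noteq> j" using diag[of i] by auto
  note z = pair_zero[OF S this diag diag ij(3)]
  have "\<not> {i, j} \<subset> supp u" using u z unfolding is_minimal_zero_of_def by metis
  then have "supp u = {i, j}" using ij by auto
  then show ?thesis using \<open>i \<noteq> j\<close> by simp
qed

text \<open>For a zero with coordinates $\alpha, \beta$ at $i, j$ the form equals
  $(\alpha - \beta)^2 + 2 \alpha \beta (1 + A_{ij})$, and copositivity makes both summands
  nonnegative.\<close>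

lemma two_point_zero:
  fixes A :: "real ^ 'n ^ 'n"
  assumes A: "A \<in> copositive_cone" and diag: "\<And>i. A $ i $ i = 1"
    and u: "is_zero_of A u" "card (supp u) = 2"
  obtains i j \<alpha> where "0 < \<alpha>" "u = \<alpha> *\<^sub>R (axis i 1 + axis j 1)"
proof -
  note sym = copositive_sym[OF A]
  obtain i j where ij: "supp u = {i, j}" "i \<noteq> j" using u(2) by (meson card_2_iff)
  define \<alpha> \<beta> a where "\<alpha> = u $ i" and "\<beta> = u $ j" and "a = A $ i $ j"
  have pos: "0 < \<alpha>" "0 < \<beta>" using ij by (auto simp: supp_def \<alpha>_def \<beta>_def)
  have nn: "nonneg_vec u" and u0: "u \<bullet> (A *v u) = 0" using u(1) by (auto simp: is_zero_of_def)
  have off: "u $ k = 0" if "k \<noteq> i" "k \<noteq> j" for k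
    using nonneg_zero_off_supp[OF nn, of k] that ij by auto
  have ueq: "u = \<alpha> *\<^sub>R axis i 1 + \<beta> *\<^sub>R axis j 1"
    using ij(2) off by (auto simp: vec_eq_iff axis_def \<alpha>_def \<beta>_def)
  have a: "- 1 \<le> a"
  proof -
    have "nonneg_vec (axis i 1 + (1::real) *\<^sub>R axis j 1)" by (simp add: nonneg_vec_def axis_def)
    from copositive_form[OF A this] show ?thesis
      unfolding form_add[OF sym] axis_form
      using diag sym_entry[OF sym, of i j] by (simp add: a_def)
  qed
  have "0 = \<alpha>\<^sup>2 + 2 * \<alpha> * \<beta> * a + \<beta>\<^sup>2"
    using u0 unfolding ueq form_add[OF sym]
    using diag sym_entry[OF sym, of i j]
    by (simp add: matrix_vector_mult_scaleR axis_form a_def power2_eq_square algebra_simps)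
  then have "(\<alpha> - \<beta>)\<^sup>2 + 2 * (\<alpha> * \<beta>) * (1 + a) = 0"
    by (simp add: power2_eq_square algebra_simps)
  moreover have "0 \<le> 2 * (\<alpha> * \<beta>) * (1 + a)" using pos a by simp
  ultimately have "(\<alpha> - \<beta>)\<^sup>2 = 0" by (smt (verit) zero_le_power2)
  then have "u = \<alpha> *\<^sub>R (axis i 1 + axis j 1)" using ueq by (simp add: scaleR_add_right)
  then show ?thesis using that pos(1) by blast
qed

text \<open>The map \<open>f\<close> erases the numbers outside \<open>{-1, 1}\<close>. It is odd, and the
  linear system that belongs to pair-supported zeros only relates opposite entries, so applying
  \<open>f\<close> entrywise turns the solution \<open>A\<close> into another solution \<open>B\<close>.
  Extremality makes \<open>B\<close> a multiple of \<open>A\<close>, and the unit diagonals force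
  \<open>B = A\<close>.\<close>

lemma unit_diagonal_extremal_entries:
  fixes A :: "real ^ 'n ^ 'n"
  assumes ext: "extremal_in copositive_cone A" and diag: "\<And>i. A $ i $ i = 1"
    and pairs: "\<And>u. is_minimal_zero_of A u \<Longrightarrow> card (supp u) = 2"
  shows "A $ i $ j \<in> {-1, 0, 1}"
proof -
  have A: "A \<in> copositive_cone" using ext by (simp add: extremal_in_def)
  define f where "f x = (if \<bar>x\<bar> = 1 then x else 0)" for x :: real
  define B where "B = (\<chi> i j. f (A $ i $ j))"
  have B: "transpose B = B"
    using sym_entry[OF copositive_sym[OF A]] by (simp add: B_def transpose_def vec_eq_iff)
  have "(B *v u) $ k = 0" if u: "is_minimal_zero_of A u" and k: "(A *v u) $ k = 0" for u k
  proof -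
    have "is_zero_of A u" using u by (simp add: is_minimal_zero_of_def)
    then obtain i j \<alpha> where u_eq: "0 < \<alpha>" "u = \<alpha> *\<^sub>R (axis i 1 + axis j 1)"
      using two_point_zero[OF A diag] pairs[OF u] by metis
    have mult: "(M *v u) $ k = \<alpha> * (M $ k $ i + M $ k $ j)" for M :: "real ^ 'n ^ 'n"
      by (simp add: u_eq(2) matrix_vector_mult_scaleR matrix_vector_right_distrib
          matrix_vector_mult_basis column_def)
    have "A $ k $ i = - A $ k $ j" using k u_eq(1) by (simp add: mult)
    then show ?thesis by (simp add: mult B_def f_def)
  qed
  then obtain c where c: "B = c *\<^sub>R A" using extremal_perturbation_multiple[OF ext B] by metis
  have "B $ i $ i = 1" by (simp add: B_def f_def diag)
  then have "B = A" using c diag by simp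
  then have "f (A $ i $ j) = A $ i $ j" by (metis B_def vec_lambda_beta)
  then show ?thesis by (auto simp: f_def abs_if split: if_splits)
qed

lemma diagonal_pos_if_zeros_pairs:
  fixes A :: "real ^ 'n ^ 'n"
  assumes A: "A \<in> copositive_cone"
    and pairs: "\<And>u. is_minimal_zero_of A u \<Longrightarrow> card (supp u) = 2"
  shows "0 < A $ i $ i"
proof (rule ccontr)
  assume "\<not> ?thesis"
  moreover have "0 \<le> A $ i $ i"
    using copositive_form[OF A nonneg_axis, of i] by (simp add: axis_form)
  ultimately have "is_zero_of A (axis i 1)"
    using nonneg_axis[of i] by (simp add: is_zero_of_def axis_form axis_eq_0_iff)
  then obtain u where u: "is_minimal_zero_of A u" "supp u \<subseteq> supp (axis i (1::real))"
    by (rule minimal_zero_below)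
  have "supp (axis i (1::real)) = {i}" by (auto simp: supp_def axis_def)
  then have "card (supp u) \<le> 1" using u(2) card_mono[of "{i}" "supp u"] by simp
  then show False using pairs[OF u(1)] by simp
qed

theorem theorem2p4:
  fixes A :: "real ^ 'n ^ 'n"
  assumes "extremal_in copositive_cone A"
  shows "(\<forall>u. is_minimal_zero_of A u \<longrightarrow> card (supp u) = 2) \<longleftrightarrow>
    (\<exists>(D :: real ^ 'n ^ 'n) (\<Sigma> :: real ^ 'n ^ 'n).
        diagonal_mat D \<and> positive_definite D \<and>
        extremal_in copositive_cone \<Sigma> \<and>
        (\<forall>i. \<Sigma> $ i $ i = 1) \<and>
        (\<forall>i j. \<Sigma> $ i $ j \<in> {-1, 0, 1}) \<and>
        A = D ** \<Sigma> ** D)"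
proof
  assume pairs: "\<forall>u. is_minimal_zero_of A u \<longrightarrow> card (supp u) = 2"
  have A: "A \<in> copositive_cone" using assms by (simp add: extremal_in_def)
  have pos: "0 < A $ i $ i" for i using diagonal_pos_if_zeros_pairs[OF A] pairs by blast
  define d where "d i = sqrt (A $ i $ i)" for i
  have d: "0 < d i" for i using pos by (simp add: d_def)
  then have d': "0 < 1 / d i" for i by simp
  define D :: "real ^ 'n ^ 'n" where "D = (\<chi> i j. if i = j then d i else 0)"
  define \<Sigma> where "\<Sigma> = diag_congruence (\<lambda>i. 1 / d i) A"
  have D: "diagonal_mat D" by (simp add: D_def diagonal_mat_def)
  have pd: "positive_definite D"
    using d by (simp add: diagonal_positive_definite_iff[OF D]) (simp add: D_def)
  have ext: "extremal_in copositive_cone \<Sigma>"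
    unfolding \<Sigma>_def using diag_congruence_extremal[of "\<lambda>i. 1 / d i", OF d' assms] .
  have unit: "\<Sigma> $ i $ i = 1" for i
    using pos[of i] by (simp add: \<Sigma>_def diag_congruence_def d_def)
  have "card (supp u) = 2" if "is_minimal_zero_of \<Sigma> u" for u
    using minimal_zeros_pairs_diag_congruence[of "\<lambda>i. 1 / d i" A u] d' pairs that
    by (auto simp: \<Sigma>_def)
  then have entries: "\<Sigma> $ i $ j \<in> {-1, 0, 1}" for i j
    by (rule unit_diagonal_extremal_entries[OF ext unit])
  have "(\<lambda>i. D $ i $ i) = d" by (simp add: D_def)
  then have "A = D ** \<Sigma> ** D"
    using diag_congruence_inverse(1)[of d A, OF d] by (simp only: diagonal_product[OF D] \<Sigma>_def)
  then show "\<exists>D \<Sigma>. diagonal_mat D \<and> positive_definite D \<and> extremal_in copositive_cone \<Sigma> \<and>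
      (\<forall>i. \<Sigma> $ i $ i = 1) \<and> (\<forall>i j. \<Sigma> $ i $ j \<in> {-1, 0, 1}) \<and> A = D ** \<Sigma> ** D"
    using D pd ext unit entries by blast
next
  assume "\<exists>D \<Sigma>. diagonal_mat D \<and> positive_definite D \<and> extremal_in copositive_cone \<Sigma> \<and>
      (\<forall>i. \<Sigma> $ i $ i = 1) \<and> (\<forall>i j. \<Sigma> $ i $ j \<in> {-1, 0, 1}) \<and> A = D ** \<Sigma> ** D"
  then obtain D \<Sigma> :: "real ^ 'n ^ 'n" where D: "diagonal_mat D" "positive_definite D"
    and \<Sigma>: "extremal_in copositive_cone \<Sigma>" "\<And>i. \<Sigma> $ i $ i = 1" "\<And>i j. \<Sigma> $ i $ j \<in> {-1, 0, 1}"
    and A: "A = D ** \<Sigma> ** D"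
    by blast
  have d: "0 < D $ i $ i" for i using D diagonal_positive_definite_iff by blast
  have "\<Sigma> \<in> copositive_cone" using \<Sigma>(1) by (simp add: extremal_in_def)
  then have "card (supp u) = 2" if "is_minimal_zero_of \<Sigma> u" for u
    using sign_matrix_minimal_zeros_pairs \<Sigma>(2,3) that by metis
  then show "\<forall>u. is_minimal_zero_of A u \<longrightarrow> card (supp u) = 2"
    using minimal_zeros_pairs_diag_congruence[of "\<lambda>i. D $ i $ i" \<Sigma>, OF d]
    unfolding A diagonal_product[OF D(1)] by blast
qed

end
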